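(* Let $n\in\mathbb{N}$, let $((\lambda_k^1,\dots,\lambda_k^n))_{k\in\mathbb{N}}$ be a sequence in $\mathbb{C}^n$ with $\Re\lambda_k^j>0$ for all $k\in\mathbb{N}$ and $1\le j\le n$, and let $1\le s\le n$ and $1\le j_1<\dots<j_s\le n$. If $((\lambda_k^1,\dots,\lambda_k^n))_{k\in\mathbb{N}}$ is a uniqueness sequence for the multidimensional Laplace transform (in $\mathbb{R}^n$), then $((\lambda_k^{j_1},\dots,\lambda_k^{j_s}))_{k\in\mathbb{N}}$ is a uniqueness sequence for the multidimensional Laplace transform in $\mathbb{R}^s$.
   Context: Let $d\in\mathbb{N}$. For a locally integrable function $f:[0,+\infty)^d\to\mathbb{C}$ (integrable on every $[0,T]^d$) and $(\lambda_1,\dots,\lambda_d)\in\mathbb{C}^d$, put $I(t_1,\dots,t_d)=\int_0^{t_1}\cdots\int_0^{t_d}e^{-\lambda_1s_1-\dots-\lambda_ds_d}f(s_1,\dots,s_d)\,ds_1\cdots ds_d$. Let $\Omega(f)$ be the set of all $(\lambda_1,\dots,\lambda_d)\in\mathbb{C}^d$ for which the limit $\hat f(\lambda_1,\dots,\lambda_d):=\lim_{t_1\to+\infty;\dots;t_d\to+\infty}I(t_1,\dots,t_d)$ (all $t_i$ tending to $+\infty$ jointly) exists, and let $\Omega_b(f)$ be the set of all $(\lambda_1,\dots,\lambda_d)\in\mathbb{C}^d$ for which $\{I(t_1,\dots,t_d): t_1,\dots,t_d\ge 0\}$ is bounded. A sequence $((\mu_k^1,\dots,\mu_k^d))_{k\in\mathbb{N}}$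 in $\mathbb{C}^d$ is a uniqueness sequence for the multidimensional Laplace transform in $\mathbb{R}^d$ if the following holds for every locally integrable $f:[0,+\infty)^d\to\mathbb{C}$: if there exist $\omega_1,\dots,\omega_d\in[-\infty,+\infty)$ with $\{\Re\lambda_1>\omega_1\}\times\dots\times\{\Re\lambda_d>\omega_d\}\subseteq\Omega_b(f)\cap\Omega(f)$ and $\omega_j<\Re\mu_k^j$ for all $k\in\mathbb{N}$, $1\le j\le d$, and if $\hat f(\mu_k^1,\dots,\mu_k^d)=0$ for all $k\in\mathbb{N}$, then $f=0$ a.e. *)

theory Defs
  imports "HOL-Analysis.Analysis"
begin

text \<open>
  Points of \<open>\<real>\<^sup>d\<close> and \<open>\<complex>\<^sup>d\<close> are functions on \<open>nat\<close> of which only the values at the indices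
  \<open>1, \<dots>, d\<close> matter. Functions on the orthant \<open>[0,\<infinity>)\<^sup>d\<close> are total; their values outside the
  orthant are never used. Indexing by \<open>nat\<close> rather than by a finite type lets the dimension be
  an ordinary variable.
\<close>

text \<open>
  \<open>d\<close>-dimensional Lebesgue measure. The completion makes Lebesgue measurable (not only Borel
  measurable) functions admissible.
\<close>

definition lebesgue_pow :: "nat \<Rightarrow> (nat \<Rightarrow> real) measure" where
  "lebesgue_pow d = completion (Pi\<^sub>M {1..d} (\<lambda>_. lborel))"

definition locally_integrable :: "nat \<Rightarrow> ((nat \<Rightarrow> real) \<Rightarrow> complex) \<Rightarrow> bool" where
  "locally_integrable d f \<longleftrightarrow>
     (\<forall>T::real. set_integrable (lebesgue_pow d) ({1..d} \<rightarrow>\<^sub>E {0..T}) f)"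

definition laplace_partial ::
  "nat \<Rightarrow> ((nat \<Rightarrow> real) \<Rightarrow> complex) \<Rightarrow> (nat \<Rightarrow> complex) \<Rightarrow> (nat \<Rightarrow> real) \<Rightarrow> complex" where
  "laplace_partial d f z t =
     (LINT s : (\<Pi>\<^sub>E i\<in>{1..d}. {0..t i}) | lebesgue_pow d.
        exp (- (\<Sum>i=1..d. z i * of_real (s i))) * f s)"

text \<open>
  The filter of \<open>t\<^sub>1 \<rightarrow> \<infinity>, \<dots>, t\<^sub>d \<rightarrow> \<infinity>\<close> jointly: the coarsest filter along which every coordinate
  tends to infinity.
\<close>

definition jointly_at_top :: "nat \<Rightarrow> (nat \<Rightarrow> real) filter" where
  "jointly_at_top d = (INF i\<in>{1..d}. filtercomap (\<lambda>t. t i) at_top)"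

lemma eventually_jointly_at_top:
  "eventually P (jointly_at_top d) \<longleftrightarrow> (\<exists>T. \<forall>t. (\<forall>i\<in>{1..d}. T \<le> t i) \<longrightarrow> P t)"
proof
  assume "eventually P (jointly_at_top d)"
  then obtain Q where Q: "\<And>i. i \<in> {1..d} \<Longrightarrow> eventually (Q i) (filtercomap (\<lambda>t. t i) at_top)"
    and QP: "\<And>t. (\<forall>i\<in>{1..d}. Q i t) \<Longrightarrow> P t"
    unfolding jointly_at_top_def eventually_INF_finite[OF finite_atLeastAtMost] by metis
  have "\<exists>c. \<forall>t. c \<le> t i \<longrightarrow> Q i t" if "i \<in> {1..d}" for i
    using Q[OF that] by (auto simp: eventually_filtercomap eventually_at_top_linorder)
  then obtain c where c: "\<And>i t. i \<in> {1..d} \<Longrightarrow> c i \<le> t i \<Longrightarrow> Q i t"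
    by metis
  have "P t" if "\<forall>i\<in>{1..d}. (\<Sum>i=1..d. \<bar>c i\<bar>) \<le> t i" for t
  proof (rule QP, rule ballI)
    fix i assume i: "i \<in> {1..d}"
    have "c i \<le> \<bar>c i\<bar>" by simp
    also have "\<dots> \<le> (\<Sum>i=1..d. \<bar>c i\<bar>)"
      using i by (intro member_le_sum) auto
    also have "\<dots> \<le> t i" using that i by blast
    finally show "Q i t" using c i by blast
  qed
  then show "\<exists>T. \<forall>t. (\<forall>i\<in>{1..d}. T \<le> t i) \<longrightarrow> P t" by blast
next
  assume "\<exists>T. \<forall>t. (\<forall>i\<in>{1..d}. T \<le> t i) \<longrightarrow> P t"
  then obtain T where T: "\<And>t. (\<forall>i\<in>{1..d}. T \<le> t i) \<Longrightarrow> P t" by blast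
  have "eventually (\<lambda>t. T \<le> t i) (jointly_at_top d)" if "i \<in> {1..d}" for i
    unfolding jointly_at_top_def using that
    by (rule eventually_INF1) (rule eventually_filtercomapI[OF eventually_ge_at_top])
  then have "eventually (\<lambda>t. \<forall>i\<in>{1..d}. T \<le> t i) (jointly_at_top d)"
    by (simp add: eventually_ball_finite)
  then show "eventually P (jointly_at_top d)"
    by (rule eventually_mono) (rule T)
qed

lemma jointly_at_top_neq_bot: "jointly_at_top d \<noteq> bot"
proof -
  have "\<exists>t::nat \<Rightarrow> real. \<forall>i\<in>{1..d}. T \<le> t i" for T
    by (rule exI[of _ "\<lambda>_. T"]) simp
  then show ?thesis
    by (simp add: trivial_limit_def eventually_jointly_at_top)
qed

definition laplace_conv_set :: "nat \<Rightarrow> ((nat \<Rightarrow> real) \<Rightarrow> complex) \<Rightarrow> (nat \<Rightarrow> complex) set" where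
  "laplace_conv_set d f = {z. \<exists>L. (laplace_partial d f z \<longlongrightarrow> L) (jointly_at_top d)}"

definition laplace_bdd_set :: "nat \<Rightarrow> ((nat \<Rightarrow> real) \<Rightarrow> complex) \<Rightarrow> (nat \<Rightarrow> complex) set" where
  "laplace_bdd_set d f = {z. bounded (laplace_partial d f z ` {t. \<forall>i\<in>{1..d}. 0 \<le> t i})}"

text \<open>Only meaningful on \<^const>\<open>laplace_conv_set\<close>; elsewhere the value is arbitrary.\<close>

definition laplace_transform ::
  "nat \<Rightarrow> ((nat \<Rightarrow> real) \<Rightarrow> complex) \<Rightarrow> (nat \<Rightarrow> complex) \<Rightarrow> complex" where
  "laplace_transform d f z = Lim (jointly_at_top d) (laplace_partial d f z)"

definition laplace_uniqueness_seq :: "nat \<Rightarrow> (nat \<Rightarrow> nat \<Rightarrow> complex) \<Rightarrow> bool" where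
  "laplace_uniqueness_seq d \<mu> \<longleftrightarrow>
     (\<forall>f. locally_integrable d f \<longrightarrow>
        (\<exists>\<omega> :: nat \<Rightarrow> ereal.
            (\<forall>j\<in>{1..d}. \<omega> j < \<infinity>) \<and>
            {z. \<forall>j\<in>{1..d}. \<omega> j < ereal (Re (z j))} \<subseteq> laplace_bdd_set d f \<inter> laplace_conv_set d f \<and>
            (\<forall>k. \<forall>j\<in>{1..d}. \<omega> j < ereal (Re (\<mu> k j)))) \<longrightarrow>
        (\<forall>k. laplace_transform d f (\<mu> k) = 0) \<longrightarrow>
        (AE t in lebesgue_pow d. (\<forall>i\<in>{1..d}. 0 \<le> t i) \<longrightarrow> f t = 0))"

end

theory Submission
  imports Defs
begin

text \<open>
  Let \<open>K\<close> be the set of coordinates of \<open>\<real>\<^sup>n\<close> that are not selected by \<open>j\<close>. A function \<open>f\<close> of the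
  selected coordinates is turned into a function of all \<open>n\<close> coordinates by multiplying it with the
  indicator of the unit cube \<open>[0,1]\<^sup>K\<close> in the others. By Fubini the partial Laplace integrals of
  this extension \<open>F\<close> factor: they are those of \<open>f\<close> times the partial Laplace integrals of the
  indicator (lemma \<open>laplace_partial_window_extension\<close>). The second factor is at most \<open>1\<close> in
  modulus when the real parts are nonnegative (\<open>norm_window_laplace_le_1\<close>), and it no longer depends
  on \<open>t\<close> once every \<open>t\<^sub>i\<close> is at least \<open>1\<close> (\<open>window_laplace_eventually_const\<close>). Hence \<open>F\<close> inherits
  boundedness and convergence from \<open>f\<close>, on the half-space given by the old abscissas in the selected
  coordinates and by \<open>0\<close> in those of \<open>K\<close>; the given sequence lies there because its real parts are
  positive. The transform of \<open>F\<close> vanishes wherever that of \<open>f\<close> does, so uniqueness in dimension \<open>n\<close>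
  gives \<open>F = 0\<close> almost everywhere. As the cube has measure \<open>1\<close>, Fubini gives \<open>f = 0\<close> almost
  everywhere (\<open>AE_zero_if_window_extension_AE_zero\<close>).

  Fubini is applied to the products of Borel measures, since the product of two completed measures
  is not complete in general. For this \<open>f\<close> is first replaced by a Borel measurable function that
  agrees with it almost everywhere on the orthant and has the same partial Laplace integrals
  (\<open>locally_integrable_borel_version\<close>).
\<close>

section \<open>Replacing Lebesgue measurable functions by Borel measurable ones\<close>

lemma completion_ex_borel_measurable_complex:
  fixes g :: "'a \<Rightarrow> complex"
  assumes "g \<in> borel_measurable (completion M)"
  shows "\<exists>g'\<in>borel_measurable M. AE x in M. g x = g' x"
proof -
  have "(\<lambda>x. Re (g x)) \<in> borel_measurable (completion M)" "(\<lambda>x. Im (g x)) \<in> borel_measurable (completion M)"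
    using assms by simp_all
  from this[THEN completion_ex_borel_measurable_real] obtain a b
    where [measurable]: "a \<in> borel_measurable M" "b \<in> borel_measurable M"
      and ab: "AE x in M. Re (g x) = a x" "AE x in M. Im (g x) = b x" by blast
  show ?thesis
  proof (rule bexI)
    show "AE x in M. g x = complex_of_real (a x) + \<i> * complex_of_real (b x)"
      using ab by eventually_elim (simp add: complex_eq_iff)
  qed measurable
qed

lemma space_lebesgue_pow: "space (lebesgue_pow d) = {1..d} \<rightarrow>\<^sub>E UNIV"
  by (simp add: lebesgue_pow_def space_PiM)

lemma box_in_sets:
  fixes a b :: "nat \<Rightarrow> real"
  assumes "finite I"
  shows "(\<Pi>\<^sub>E i\<in>I. {a i..b i}) \<in> sets (Pi\<^sub>M I (\<lambda>_. lborel))"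
  using assms by (intro sets_PiM_I_finite) auto

lemma measurable_exp_linear:
  "(\<lambda>x. exp (- (\<Sum>i\<in>I. z i * of_real (x i))) :: complex) \<in> borel_measurable (Pi\<^sub>M I (\<lambda>_. lborel))"
proof -
  have "continuous_on UNIV (exp :: complex \<Rightarrow> complex)" by (intro continuous_intros)
  then have "(exp :: complex \<Rightarrow> complex) \<in> borel_measurable borel" by (rule borel_measurable_continuous_onI)
  moreover have "(\<lambda>x. - (\<Sum>i\<in>I. z i * of_real (x i)) :: complex) \<in> borel_measurable (Pi\<^sub>M I (\<lambda>_. lborel))"
    by measurable
  ultimately show ?thesis by (rule measurable_compose[rotated])
qed

text \<open>
  The orthant is the increasing union of the cubes \<open>[0,k]\<^sup>d\<close>, so measurability on all cubes gives
  measurability on the orthant.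
\<close>

lemma locally_integrable_measurable_on_orthant:
  assumes "locally_integrable d f"
  shows "(\<lambda>x. indicator ({1..d} \<rightarrow>\<^sub>E {0..}) x *\<^sub>R f x) \<in> borel_measurable (lebesgue_pow d)"
proof (rule borel_measurable_LIMSEQ_metric)
  show "(\<lambda>x. indicator ({1..d} \<rightarrow>\<^sub>E {0..real k}) x *\<^sub>R f x) \<in> borel_measurable (lebesgue_pow d)" for k
    using assms unfolding locally_integrable_def set_integrable_def
    by (auto intro: borel_measurable_integrable)
next
  fix x assume "x \<in> space (lebesgue_pow d)"
  then have x: "x \<in> extensional {1..d}" by (simp add: space_lebesgue_pow PiE_def)
  obtain m where m: "(\<Sum>i=1..d. \<bar>x i\<bar>) \<le> real m" using real_arch_simple by blast
  have "x i \<le> real k" if "k \<ge> m" "i \<in> {1..d}" for k i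
  proof -
    have "x i \<le> \<bar>x i\<bar>" by simp
    also have "\<dots> \<le> (\<Sum>i=1..d. \<bar>x i\<bar>)" using that by (intro member_le_sum) auto
    finally show ?thesis using m that by simp
  qed
  then have "\<forall>k\<ge>m. indicator ({1..d} \<rightarrow>\<^sub>E {0..real k}) x *\<^sub>R f x
              = indicator ({1..d} \<rightarrow>\<^sub>E {0..}) x *\<^sub>R f x"
    using x by (auto simp: indicator_def PiE_iff)
  then show "(\<lambda>k. indicator ({1..d} \<rightarrow>\<^sub>E {0..real k}) x *\<^sub>R f x)
      \<longlonglongrightarrow> indicator ({1..d} \<rightarrow>\<^sub>E {0..}) x *\<^sub>R f x"
    by (intro tendsto_eventually) (auto simp: eventually_sequentially)
qed

text \<open>
  The hypothesis says nothing about \<open>f\<close> outside the orthant, where \<open>f\<close> need not even be measurable.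
  The Borel version is therefore taken of \<open>f\<close> cut off to the orthant; all integrals in question are
  over boxes inside the orthant.
\<close>

lemma locally_integrable_borel_version:
  assumes f: "locally_integrable d f"
  obtains g where "g \<in> borel_measurable (Pi\<^sub>M {1..d} (\<lambda>_. lborel))"
    and "AE x in lebesgue_pow d. (\<forall>i\<in>{1..d}. 0 \<le> x i) \<longrightarrow> f x = g x"
    and "locally_integrable d g"
    and "laplace_partial d g = laplace_partial d f"
proof -
  let ?h = "\<lambda>x. indicator ({1..d} \<rightarrow>\<^sub>E {0..}) x *\<^sub>R f x"
  have h[measurable]: "?h \<in> borel_measurable (lebesgue_pow d)"
    by (rule locally_integrable_measurable_on_orthant[OF f])
  then obtain g where g[measurable]: "g \<in> borel_measurable (Pi\<^sub>M {1..d} (\<lambda>_. lborel))"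
    and "AE x in Pi\<^sub>M {1..d} (\<lambda>_. lborel). ?h x = g x"
    using completion_ex_borel_measurable_complex unfolding lebesgue_pow_def by blast
  then have hg: "AE x in lebesgue_pow d. ?h x = g x"
    unfolding lebesgue_pow_def by (intro AE_completion)
  have g'[measurable]: "g \<in> borel_measurable (lebesgue_pow d)"
    unfolding lebesgue_pow_def using g by (rule measurable_completion)
  have box[measurable]: "(\<Pi>\<^sub>E i\<in>{1..d}. {0..t i}) \<in> sets (lebesgue_pow d)" for t :: "nat \<Rightarrow> real"
    unfolding lebesgue_pow_def by (intro sets_completionI_sets box_in_sets) auto
  have [measurable]: "(\<lambda>x. exp (- (\<Sum>i=1..d. z i * of_real (x i))) :: complex) \<in> borel_measurable (lebesgue_pow d)" for z
    unfolding lebesgue_pow_def by (intro measurable_completion measurable_exp_linear)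
  have eq: "indicator (\<Pi>\<^sub>E i\<in>{1..d}. {0..t i}) x *\<^sub>R (c * f x) = 
            indicator (\<Pi>\<^sub>E i\<in>{1..d}. {0..t i}) x *\<^sub>R (c * ?h x)" for t x c
    by (auto simp: indicator_def PiE_iff)
  show ?thesis
  proof (rule that[OF g])
    show "AE x in lebesgue_pow d. (\<forall>i\<in>{1..d}. 0 \<le> x i) \<longrightarrow> f x = g x"
      using hg AE_space
      by eventually_elim (auto simp: space_lebesgue_pow PiE_iff indicator_def split: if_splits)
    show "locally_integrable d g"
      unfolding locally_integrable_def set_integrable_def
    proof
      fix T :: real
      have "integrable (lebesgue_pow d) (\<lambda>x. indicator ({1..d} \<rightarrow>\<^sub>E {0..T}) x *\<^sub>R (1 * ?h x))"
        using f unfolding locally_integrable_def set_integrable_def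
        unfolding eq[of "\<lambda>_. T", symmetric] by simp
      then show "integrable (lebesgue_pow d) (\<lambda>x. indicator ({1..d} \<rightarrow>\<^sub>E {0..T}) x *\<^sub>R g x)"
      proof (rule integrable_cong_AE_imp)
        show "(\<lambda>x. indicator ({1..d} \<rightarrow>\<^sub>E {0..T}) x *\<^sub>R g x) \<in> borel_measurable (lebesgue_pow d)"
          using box[of "\<lambda>_. T"] by measurable
        show "AE x in lebesgue_pow d. indicator ({1..d} \<rightarrow>\<^sub>E {0..T}) x *\<^sub>R (1 * ?h x)
            = indicator ({1..d} \<rightarrow>\<^sub>E {0..T}) x *\<^sub>R g x"
          using hg by eventually_elim simp
      qed
    qed
    show "laplace_partial d g = laplace_partial d f"
      unfolding laplace_partial_def set_lebesgue_integral_def eq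
    proof (intro ext integral_cong_AE)
      fix z t
      show "AE x in lebesgue_pow d. indicator (\<Pi>\<^sub>E i\<in>{1..d}. {0..t i}) x *\<^sub>R (exp (- (\<Sum>i=1..d. z i * of_real (x i))) * g x) =
        indicator (\<Pi>\<^sub>E i\<in>{1..d}. {0..t i}) x *\<^sub>R (exp (- (\<Sum>i=1..d. z i * of_real (x i))) * ?h x)"
        using hg by eventually_elim simp
    qed measurable
  qed
qed

section \<open>Splitting the coordinates into two groups\<close>

interpretation lborel_product: product_sigma_finite "\<lambda>_::nat. lborel :: real measure"
  by standard

text \<open>
  The point of \<open>\<real>\<^bsup>j ` A \<union> K\<^esup>\<close> with \<open>K\<close>-coordinates \<open>y\<close> whose coordinate at \<open>j a\<close> is \<open>x a\<close>. Merging and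
  renumbering are done in one step, so that one change of variables serves for both.
\<close>

definition glue :: "(nat \<Rightarrow> nat) \<Rightarrow> nat set \<Rightarrow> nat set \<Rightarrow> (nat \<Rightarrow> real) \<times> (nat \<Rightarrow> real) \<Rightarrow> nat \<Rightarrow> real" where
  "glue j A K = (\<lambda>(x, y). \<lambda>i\<in>j ` A \<union> K. if i \<in> j ` A then x (inv_into A j i) else y i)"

lemma glue_reindexed: "inj_on j A \<Longrightarrow> a \<in> A \<Longrightarrow> glue j A K (x, y) (j a) = x a"
  by (simp add: glue_def)

lemma glue_other: "i \<in> K \<Longrightarrow> j ` A \<inter> K = {} \<Longrightarrow> glue j A K (x, y) i = y i"
  by (auto simp: glue_def)

lemma glue_in_PiE_iff:
  assumes "inj_on j A" "j ` A \<inter> K = {}" "x \<in> extensional A" "y \<in> extensional K"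
  shows "glue j A K (x, y) \<in> (\<Pi>\<^sub>E i\<in>j ` A \<union> K. B i) \<longleftrightarrow> x \<in> (\<Pi>\<^sub>E a\<in>A. B (j a)) \<and> y \<in> (\<Pi>\<^sub>E i\<in>K. B i)"
proof -
  have "glue j A K (x, y) \<in> extensional (j ` A \<union> K)" by (simp add: glue_def)
  then show ?thesis
    using assms by (auto simp: PiE_iff glue_reindexed glue_other ball_Un)
qed

lemma measurable_glue:
  assumes "inj_on j A"
  shows "glue j A K \<in> Pi\<^sub>M A (\<lambda>_. lborel) \<Otimes>\<^sub>M Pi\<^sub>M K (\<lambda>_. lborel) \<rightarrow>\<^sub>M Pi\<^sub>M (j ` A \<union> K) (\<lambda>_. lborel)"
  unfolding glue_def case_prod_unfold
proof (rule measurable_restrict)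
  fix i assume i: "i \<in> j ` A \<union> K"
  show "(\<lambda>p. if i \<in> j ` A then fst p (inv_into A j i) else snd p i)
     \<in> Pi\<^sub>M A (\<lambda>_. lborel) \<Otimes>\<^sub>M Pi\<^sub>M K (\<lambda>_. lborel) \<rightarrow>\<^sub>M lborel"
  proof (cases "i \<in> j ` A")
    case True
    then have [measurable]: "inv_into A j i \<in> A" by (rule inv_into_into)
    show ?thesis using True by simp
  next
    case False
    then have [measurable]: "i \<in> K" using i by simp
    show ?thesis using False by simp
  qed
qed

text \<open>
  Gluing carries product measure to product measure: a box pulls back to a product of two boxes, and
  the measures of boxes determine a product of sigma-finite measures.
\<close>

lemma distr_glue:
  assumes j: "inj_on j A" "j ` A \<inter> K = {}" and fin: "finite A" "finite K"
  shows "distr (Pi\<^sub>M A (\<lambda>_. lborel) \<Otimes>\<^sub>M Pi\<^sub>M K (\<lambda>_. lborel)) (Pi\<^sub>M (j ` A \<union> K) (\<lambda>_. lborel)) (glue j A K)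
     = Pi\<^sub>M (j ` A \<union> K) (\<lambda>_. lborel)"
proof (rule lborel_product.PiM_eqI)
  interpret K: sigma_finite_measure "Pi\<^sub>M K (\<lambda>_. lborel :: real measure)"
    by (rule lborel_product.sigma_finite[OF fin(2)])
  fix B :: "nat \<Rightarrow> real set" assume B: "\<And>i. i \<in> j ` A \<union> K \<Longrightarrow> B i \<in> sets lborel"
  have "glue j A K -` (\<Pi>\<^sub>E i\<in>j ` A \<union> K. B i) \<inter> space (Pi\<^sub>M A (\<lambda>_. lborel) \<Otimes>\<^sub>M Pi\<^sub>M K (\<lambda>_. lborel))
      = (\<Pi>\<^sub>E a\<in>A. B (j a)) \<times> (\<Pi>\<^sub>E i\<in>K. B i)"
    using glue_in_PiE_iff[OF j, of _ _ B]
    by (auto simp: space_pair_measure space_PiM PiE_iff)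
  then show "emeasure (distr (Pi\<^sub>M A (\<lambda>_. lborel) \<Otimes>\<^sub>M Pi\<^sub>M K (\<lambda>_. lborel)) (Pi\<^sub>M (j ` A \<union> K) (\<lambda>_. lborel)) (glue j A K))
       (\<Pi>\<^sub>E i\<in>j ` A \<union> K. B i) = (\<Prod>i\<in>j ` A \<union> K. emeasure lborel (B i))"
    using B fin j
    by (simp add: emeasure_distr measurable_glue sets_PiM_I_finite K.emeasure_pair_measure_Times
        lborel_product.emeasure_PiM prod.union_disjoint prod.reindex)
qed (use fin in auto)

lemma (in pair_sigma_finite)
  fixes a :: "'a \<Rightarrow> complex" and b :: "'b \<Rightarrow> complex"
  assumes a: "integrable M1 a" and b: "integrable M2 b"
  shows integrable_product_function: "integrable (M1 \<Otimes>\<^sub>M M2) (\<lambda>p. a (fst p) * b (snd p))"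
    and integral_product_function:
      "(LINT p|(M1 \<Otimes>\<^sub>M M2). a (fst p) * b (snd p)) = (LINT x|M1. a x) * (LINT y|M2. b y)"
proof -
  note [measurable] = borel_measurable_integrable[OF a] borel_measurable_integrable[OF b]
  show i: "integrable (M1 \<Otimes>\<^sub>M M2) (\<lambda>p. a (fst p) * b (snd p))"
    by (rule Fubini_integrable) (use a b in \<open>auto simp: norm_mult\<close>)
  show "(LINT p|(M1 \<Otimes>\<^sub>M M2). a (fst p) * b (snd p)) = (LINT x|M1. a x) * (LINT y|M2. b y)"
    using integral_fst'[OF i] by simp
qed


section \<open>Extending a function by a window in the remaining coordinates\<close>

definition window_extension ::
  "nat \<Rightarrow> (nat \<Rightarrow> nat) \<Rightarrow> nat set \<Rightarrow> ((nat \<Rightarrow> real) \<Rightarrow> complex) \<Rightarrow> (nat \<Rightarrow> real) \<Rightarrow> complex" where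
  "window_extension s j K g u = (if \<forall>i\<in>K. u i \<in> {0..1} then g (\<lambda>i\<in>{1..s}. u (j i)) else 0)"

text \<open>
  The partial Laplace integral of the indicator of \<open>[0,1]\<^sup>K\<close>, with the indicator absorbed into the
  domain of integration.
\<close>

definition window_laplace :: "nat set \<Rightarrow> (nat \<Rightarrow> complex) \<Rightarrow> (nat \<Rightarrow> real) \<Rightarrow> complex" where
  "window_laplace K z t =
     (LINT y : (\<Pi>\<^sub>E i\<in>K. {0..min 1 (t i)}) | Pi\<^sub>M K (\<lambda>_. lborel). exp (- (\<Sum>i\<in>K. z i * of_real (y i))))"

lemma norm_exp_linear_le:
  fixes x t :: "nat \<Rightarrow> real"
  assumes "\<And>i. i \<in> I \<Longrightarrow> x i \<in> {0..t i}"
  shows "norm (exp (- (\<Sum>i\<in>I. z i * of_real (x i))) :: complex) \<le> exp (\<Sum>i\<in>I. norm (z i) * t i)"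
proof -
  have "norm (exp (- (\<Sum>i\<in>I. z i * of_real (x i))) :: complex) \<le> exp (norm (\<Sum>i\<in>I. z i * of_real (x i)))"
    using norm_exp[of "- (\<Sum>i\<in>I. z i * of_real (x i))"] by simp
  also have "norm (\<Sum>i\<in>I. z i * of_real (x i)) \<le> (\<Sum>i\<in>I. norm (z i) * t i)"
    using assms by (intro sum_norm_le) (auto simp: norm_mult intro!: mult_left_mono)
  finally show ?thesis by simp
qed

lemma emeasure_box_finite:
  fixes a b :: "nat \<Rightarrow> real"
  assumes "finite K"
  shows "emeasure (Pi\<^sub>M K (\<lambda>_. lborel)) (\<Pi>\<^sub>E i\<in>K. {a i..b i}) < \<infinity>"
  using assms by (subst lborel_product.emeasure_PiM) (auto simp: ennreal_prod_eq_top emeasure_lborel_Icc_eq less_top[symmetric])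

lemma integrable_window_laplace:
  fixes z :: "nat \<Rightarrow> complex"
  assumes K: "finite K"
  shows "set_integrable (Pi\<^sub>M K (\<lambda>_. lborel)) (\<Pi>\<^sub>E i\<in>K. {0..min 1 (t i)})
           (\<lambda>y. exp (- (\<Sum>i\<in>K. z i * of_real (y i))))"
  unfolding set_integrable_def
proof (rule integrableI_bounded_set_indicator[where B = "exp (\<Sum>i\<in>K. norm (z i) * min 1 (t i))"])
  show "AE x\<in>\<Pi>\<^sub>E i\<in>K. {0..min 1 (t i)} in Pi\<^sub>M K (\<lambda>_. lborel).
      cmod (exp (- (\<Sum>i\<in>K. z i * of_real (x i)))) \<le> exp (\<Sum>i\<in>K. norm (z i) * min 1 (t i))"
    by (intro AE_I2 impI norm_exp_linear_le) (auto simp: PiE_iff)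
qed (intro box_in_sets emeasure_box_finite measurable_exp_linear K)+

lemma norm_window_laplace_le_1:
  assumes K: "finite K" and z: "\<And>i. i \<in> K \<Longrightarrow> 0 \<le> Re (z i)"
  shows "norm (window_laplace K z t) \<le> 1"
proof -
  let ?M = "Pi\<^sub>M K (\<lambda>_. lborel :: real measure)"
  have "norm (window_laplace K z t) \<le> (LINT y|?M. indicator (\<Pi>\<^sub>E i\<in>K. {0..1}) y)"
    unfolding window_laplace_def set_lebesgue_integral_def
  proof (rule order_trans[OF integral_norm_bound integral_mono])
    show "integrable ?M (\<lambda>y. norm (indicator (\<Pi>\<^sub>E i\<in>K. {0..min 1 (t i)}) y *\<^sub>R exp (- (\<Sum>i\<in>K. z i * of_real (y i)))))"
      using integrable_window_laplace[OF K] unfolding set_integrable_def by (rule integrable_norm)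
    show "integrable ?M (indicator (\<Pi>\<^sub>E i\<in>K. {0..1}) :: _ \<Rightarrow> real)"
      using K by (intro integrable_real_indicator box_in_sets emeasure_box_finite)
    fix y
    have "0 \<le> (\<Sum>i\<in>K. Re (z i) * y i)" if "\<And>i. i \<in> K \<Longrightarrow> 0 \<le> y i"
      using that z by (intro sum_nonneg mult_nonneg_nonneg) auto
    then show "norm (indicator (\<Pi>\<^sub>E i\<in>K. {0..min 1 (t i)}) y *\<^sub>R exp (- (\<Sum>i\<in>K. z i * of_real (y i)))) 
        \<le> indicator (\<Pi>\<^sub>E i\<in>K. {0..1}) y"
      by (auto simp: indicator_def PiE_iff)
  qed
  also have "\<dots> = 1"
    using K by (simp add: measure_def lborel_product.emeasure_PiM box_in_sets Int_absorb2 sets.sets_into_space)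
  finally show ?thesis .
qed

lemma window_laplace_eventually_const:
  "\<forall>i\<in>K. 1 \<le> t i \<Longrightarrow> window_laplace K z t = window_laplace K z (\<lambda>_. 1)"
  unfolding window_laplace_def
  by (rule arg_cong[where f = "\<lambda>B. LINT y:B|Pi\<^sub>M K (\<lambda>_. lborel). exp (- (\<Sum>i\<in>K. z i * of_real (y i)))"])
    (rule PiE_cong, simp)

lemma measurable_window_extension:
  assumes g: "g \<in> borel_measurable (Pi\<^sub>M {1..s} (\<lambda>_. lborel))"
    and I: "j ` {1..s} \<union> K = I" and K: "finite K"
  shows "window_extension s j K g \<in> borel_measurable (Pi\<^sub>M I (\<lambda>_. lborel))"
proof -
  have [measurable]: "(\<lambda>u. u i) \<in> Pi\<^sub>M I (\<lambda>_. lborel :: real measure) \<rightarrow>\<^sub>M lborel" if "i \<in> I" for i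
    using that by measurable
  have "(\<lambda>u. \<lambda>i\<in>{1..s}. u (j i)) \<in> Pi\<^sub>M I (\<lambda>_. lborel :: real measure) \<rightarrow>\<^sub>M Pi\<^sub>M {1..s} (\<lambda>_. lborel)"
    using I by (intro measurable_restrict measurable_component_singleton) auto
  from measurable_compose[OF this g]
  have [measurable]: "(\<lambda>u. g (\<lambda>i\<in>{1..s}. u (j i))) \<in> borel_measurable (Pi\<^sub>M I (\<lambda>_. lborel))" .
  have "Measurable.pred (Pi\<^sub>M I (\<lambda>_. lborel :: real measure)) (\<lambda>u. \<forall>i\<in>K. u i \<in> {0..1})"
  proof (intro pred_intros_finite K)
    fix i assume "i \<in> K"
    then have "i \<in> I" using I by auto
    then show "Measurable.pred (Pi\<^sub>M I (\<lambda>_. lborel :: real measure)) (\<lambda>u. u i \<in> {0..1})"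
      by measurable
  qed
  then show ?thesis
    unfolding window_extension_def by measurable
qed

locale coordinate_split =
  fixes n s :: nat and j :: "nat \<Rightarrow> nat" and K :: "nat set"
  assumes inj: "inj_on j {1..s}" and disj: "j ` {1..s} \<inter> K = {}"
    and un: "j ` {1..s} \<union> K = {1..n}"
begin

lemma finite_K: "finite K"
  using un by (metis finite_Un finite_atLeastAtMost)

lemma j_in: "i \<in> {1..s} \<Longrightarrow> j i \<in> {1..n}"
  using un by blast

lemma window_extension_glue:
  assumes "x \<in> extensional {1..s}"
  shows "window_extension s j K g (glue j {1..s} K (x, y)) = (if \<forall>i\<in>K. y i \<in> {0..1} then g x else 0)"
proof -
  have "(\<lambda>i\<in>{1..s}. glue j {1..s} K (x, y) (j i)) = x"
    using assms inj by (auto simp: glue_reindexed extensional_def restrict_def fun_eq_iff)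
  then show ?thesis
    using disj by (simp add: window_extension_def glue_other)
qed

lemma sum_glue:
  "(\<Sum>i=1..n. z i * complex_of_real (glue j {1..s} K (x, y) i))
     = (\<Sum>i=1..s. z (j i) * of_real (x i)) + (\<Sum>i\<in>K. z i * of_real (y i))"
  unfolding un[symmetric] using disj finite_K inj
  by (simp add: sum.union_disjoint sum.reindex glue_reindexed glue_other)

text \<open>
  Box, exponential and extension all factor along the two groups of coordinates. The constraint
  \<open>y\<^sub>i \<le> 1\<close> of the window merges with \<open>y\<^sub>i \<le> t\<^sub>i\<close> into the upper limit \<open>min 1 (t i)\<close>.
\<close>

lemma laplace_integrand_glue:
  assumes x: "x \<in> extensional {1..s}" and y: "y \<in> extensional K"
  shows "indicator (\<Pi>\<^sub>E i\<in>{1..n}. {0..t i}) (glue j {1..s} K (x, y)) *\<^sub>R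
      (exp (- (\<Sum>i=1..n. z i * of_real (glue j {1..s} K (x, y) i))) * window_extension s j K g (glue j {1..s} K (x, y)))
    = (indicator (\<Pi>\<^sub>E i\<in>{1..s}. {0..t (j i)}) x *\<^sub>R (exp (- (\<Sum>i=1..s. z (j i) * of_real (x i))) * g x)) *
      (indicator (\<Pi>\<^sub>E i\<in>K. {0..min 1 (t i)}) y *\<^sub>R exp (- (\<Sum>i\<in>K. z i * of_real (y i))))"
proof -
  have 1: "glue j {1..s} K (x, y) \<in> (\<Pi>\<^sub>E i\<in>{1..n}. {0..t i}) \<longleftrightarrow>
      x \<in> (\<Pi>\<^sub>E i\<in>{1..s}. {0..t (j i)}) \<and> y \<in> (\<Pi>\<^sub>E i\<in>K. {0..t i})"
    using glue_in_PiE_iff[OF inj disj x y] unfolding un .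
  have 2: "y \<in> (\<Pi>\<^sub>E i\<in>K. {0..min 1 (t i)}) \<longleftrightarrow> y \<in> (\<Pi>\<^sub>E i\<in>K. {0..t i}) \<and> (\<forall>i\<in>K. y i \<in> {0..1})"
    using y by (auto simp: PiE_iff)
  show ?thesis
    unfolding sum_glue window_extension_glue[OF x] minus_add_distrib exp_add indicator_def 1 2
    by auto
qed

text \<open>
  Both claims come from the same pull-back along the gluing map. The case \<open>z = 0\<close> of the first one is
  local integrability of the extension.
\<close>

lemma
  assumes g: "g \<in> borel_measurable (Pi\<^sub>M {1..s} (\<lambda>_. lborel))" and loc: "locally_integrable s g"
  shows integrable_window_extension:
      "set_integrable (lebesgue_pow n) (\<Pi>\<^sub>E i\<in>{1..n}. {0..t i})
         (\<lambda>u. exp (- (\<Sum>i=1..n. z i * of_real (u i))) * window_extension s j K g u)" (is ?I)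
    and laplace_partial_window_extension:
      "laplace_partial n (window_extension s j K g) z t
         = laplace_partial s g (\<lambda>i. z (j i)) (\<lambda>i. t (j i)) * window_laplace K z t" (is ?E)
proof -
  let ?S = "Pi\<^sub>M {1..s} (\<lambda>_. lborel :: real measure)"
  let ?K = "Pi\<^sub>M K (\<lambda>_. lborel :: real measure)"
  let ?N = "Pi\<^sub>M {1..n} (\<lambda>_. lborel :: real measure)"
  interpret S: sigma_finite_measure ?S by (rule lborel_product.sigma_finite) simp
  interpret K: sigma_finite_measure ?K by (rule lborel_product.sigma_finite[OF finite_K])
  interpret pair_sigma_finite ?S ?K ..
  note [measurable] = g
  let ?a = "\<lambda>x. indicator (\<Pi>\<^sub>E i\<in>{1..s}. {0..t (j i)}) x *\<^sub>R (exp (- (\<Sum>i=1..s. z (j i) * of_real (x i))) * g x)"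
  let ?b = "\<lambda>y. indicator (\<Pi>\<^sub>E i\<in>K. {0..min 1 (t i)}) y *\<^sub>R exp (- (\<Sum>i\<in>K. z i * of_real (y i))) :: complex"
  let ?F = "\<lambda>u. indicator (\<Pi>\<^sub>E i\<in>{1..n}. {0..t i}) u *\<^sub>R (exp (- (\<Sum>i=1..n. z i * of_real (u i))) * window_extension s j K g u)"
  \<comment> \<open>The box has a side for each coordinate, but local integrability speaks of cubes.\<close>
  define T where "T = (\<Sum>i=1..s. \<bar>t (j i)\<bar>)"
  have T: "t (j i) \<le> T" if "i \<in> {1..s}" for i
  proof -
    have "t (j i) \<le> \<bar>t (j i)\<bar>" by simp
    also have "\<dots> \<le> T" unfolding T_def using that by (intro member_le_sum) auto
    finally show ?thesis .
  qed
  have am: "?a \<in> borel_measurable ?S"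
    using box_in_sets[of "{1..s}" "\<lambda>_. 0" "\<lambda>i. t (j i)"] measurable_exp_linear[of "\<lambda>i. z (j i)" "{1..s}"]
    by measurable
  have loc_m: "(\<lambda>x. indicator ({1..s} \<rightarrow>\<^sub>E {0..T}) x *\<^sub>R g x) \<in> borel_measurable ?S"
    using box_in_sets[of "{1..s}" "\<lambda>_. 0" "\<lambda>_. T"] by measurable
  have loc': "integrable ?S (\<lambda>x. indicator ({1..s} \<rightarrow>\<^sub>E {0..T}) x *\<^sub>R g x)"
    using loc unfolding locally_integrable_def set_integrable_def lebesgue_pow_def
      integrable_completion[OF loc_m, symmetric] by blast
  have a: "integrable ?S ?a"
  proof (rule Bochner_Integration.integrable_bound)
    let ?C = "exp (\<Sum>i=1..s. norm (z (j i)) * t (j i))"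
    show "integrable ?S (\<lambda>x. ?C *\<^sub>R (indicator ({1..s} \<rightarrow>\<^sub>E {0..T}) x *\<^sub>R g x))"
      using loc' by (rule integrable_scaleR_right)
    show "AE x in ?S. norm (?a x) \<le> norm (?C *\<^sub>R (indicator ({1..s} \<rightarrow>\<^sub>E {0..T}) x *\<^sub>R g x))"
    proof (rule AE_I2)
      fix x
      show "norm (?a x) \<le> norm (?C *\<^sub>R (indicator ({1..s} \<rightarrow>\<^sub>E {0..T}) x *\<^sub>R g x))"
      proof (cases "x \<in> (\<Pi>\<^sub>E i\<in>{1..s}. {0..t (j i)})")
        case True
        then have "x \<in> {1..s} \<rightarrow>\<^sub>E {0..T}"
          by (auto simp: PiE_iff intro: order_trans[OF _ T])
        moreover have "norm (exp (- (\<Sum>i=1..s. z (j i) * of_real (x i)))) \<le> ?C"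
          using True by (intro norm_exp_linear_le) (auto simp: PiE_iff)
        ultimately show ?thesis
          using True by (simp add: norm_mult mult_right_mono del: norm_exp_eq_Re)
      qed simp
    qed
  qed (rule am)
  have b: "integrable ?K ?b"
    using integrable_window_laplace[OF finite_K] unfolding set_integrable_def .
  have glue[measurable]: "glue j {1..s} K \<in> ?S \<Otimes>\<^sub>M ?K \<rightarrow>\<^sub>M ?N"
    using measurable_glue[OF inj, of K] unfolding un .
  have distr: "?N = distr (?S \<Otimes>\<^sub>M ?K) ?N (glue j {1..s} K)"
    using distr_glue[OF inj disj finite_atLeastAtMost finite_K] unfolding un by simp
  have F: "?F \<in> borel_measurable ?N"
    using box_in_sets[of "{1..n}" "\<lambda>_. 0" t] measurable_exp_linear[of z "{1..n}"]
      measurable_window_extension[OF g un finite_K]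
    by measurable
  have F_glue: "?F (glue j {1..s} K p) = ?a (fst p) * ?b (snd p)" if "p \<in> space (?S \<Otimes>\<^sub>M ?K)" for p
    using that laplace_integrand_glue[of "fst p" "snd p" t z g]
    by (auto simp: space_pair_measure space_PiM PiE_iff)
  have "integrable (?S \<Otimes>\<^sub>M ?K) (\<lambda>p. ?F (glue j {1..s} K p))"
    using integrable_product_function[OF a b] F_glue
    by (subst Bochner_Integration.integrable_cong[OF refl]) auto
  then have "integrable ?N ?F"
    by (subst distr) (rule integrable_distr_eq[THEN iffD2, OF glue F])
  then show ?I
    unfolding set_integrable_def lebesgue_pow_def by (simp only: integrable_completion[OF F])
  have "laplace_partial n (window_extension s j K g) z t = integral\<^sup>L ?N ?F"
    unfolding laplace_partial_def set_lebesgue_integral_def lebesgue_pow_def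
    by (rule integral_completion[OF F])
  also have "\<dots> = (LINT p|(?S \<Otimes>\<^sub>M ?K). ?F (glue j {1..s} K p))"
    by (subst distr) (rule integral_distr[OF glue F])
  also have "\<dots> = (LINT p|(?S \<Otimes>\<^sub>M ?K). ?a (fst p) * ?b (snd p))"
    by (rule Bochner_Integration.integral_cong[OF refl F_glue])
  also have "\<dots> = (LINT x|?S. ?a x) * (LINT y|?K. ?b y)"
    by (rule integral_product_function[OF a b])
  also have "(LINT x|?S. ?a x) = laplace_partial s g (\<lambda>i. z (j i)) (\<lambda>i. t (j i))"
    unfolding laplace_partial_def set_lebesgue_integral_def lebesgue_pow_def
    by (rule integral_completion[OF am, symmetric])
  finally show ?E
    unfolding window_laplace_def set_lebesgue_integral_def .
qed

lemma locally_integrable_window_extension: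
  assumes "g \<in> borel_measurable (Pi\<^sub>M {1..s} (\<lambda>_. lborel))" and "locally_integrable s g"
  shows "locally_integrable n (window_extension s j K g)"
  unfolding locally_integrable_def
  using integrable_window_extension[OF assms, of "\<lambda>_. T" "\<lambda>_. 0" for T] by simp

lemma filterlim_reindex_jointly_at_top:
  "filterlim (\<lambda>t i. t (j i)) (jointly_at_top s) (jointly_at_top n)"
  unfolding filterlim_iff eventually_jointly_at_top
proof (intro allI impI)
  fix P assume "\<exists>T::real. \<forall>t. (\<forall>i\<in>{1..s}. T \<le> t i) \<longrightarrow> P t"
  then obtain T :: real where T: "\<And>t. (\<forall>i\<in>{1..s}. T \<le> t i) \<Longrightarrow> P t" by blast
  show "\<exists>T::real. \<forall>t. (\<forall>i\<in>{1..n}. T \<le> t i) \<longrightarrow> P (\<lambda>i. t (j i))"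
    by (intro exI[of _ T] allI impI T ballI) (use j_in in blast)
qed

lemma tendsto_window_laplace:
  "(window_laplace K z \<longlongrightarrow> window_laplace K z (\<lambda>_. 1)) (jointly_at_top n)"
proof (rule tendsto_eventually)
  have "window_laplace K z t = window_laplace K z (\<lambda>_. 1)" if "\<forall>i\<in>{1..n}. 1 \<le> t i" for t
    using that un by (intro window_laplace_eventually_const) blast
  then show "\<forall>\<^sub>F t in jointly_at_top n. window_laplace K z t = window_laplace K z (\<lambda>_. 1)"
    unfolding eventually_jointly_at_top by blast
qed

lemma tendsto_laplace_partial_window_extension:
  assumes g: "g \<in> borel_measurable (Pi\<^sub>M {1..s} (\<lambda>_. lborel))" "locally_integrable s g"
    and L: "(laplace_partial s g (\<lambda>i. z (j i)) \<longlongrightarrow> L) (jointly_at_top s)"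
  shows "(laplace_partial n (window_extension s j K g) z \<longlongrightarrow> L * window_laplace K z (\<lambda>_. 1)) (jointly_at_top n)"
  unfolding laplace_partial_window_extension[OF g, abs_def]
  by (intro tendsto_mult tendsto_window_laplace filterlim_compose[OF L filterlim_reindex_jointly_at_top])

lemma laplace_bdd_set_window_extension:
  assumes g: "g \<in> borel_measurable (Pi\<^sub>M {1..s} (\<lambda>_. lborel))" "locally_integrable s g"
    and z: "(\<lambda>i. z (j i)) \<in> laplace_bdd_set s g" and pos: "\<And>i. i \<in> K \<Longrightarrow> 0 \<le> Re (z i)"
  shows "z \<in> laplace_bdd_set n (window_extension s j K g)"
proof -
  obtain B where B: "\<And>t. \<forall>i\<in>{1..s}. 0 \<le> t i \<Longrightarrow> norm (laplace_partial s g (\<lambda>i. z (j i)) t) \<le> B"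
    using z unfolding laplace_bdd_set_def bounded_iff by auto
  have "norm (laplace_partial n (window_extension s j K g) z t) \<le> B * 1" if "\<forall>i\<in>{1..n}. 0 \<le> t i" for t
  proof -
    have t: "norm (laplace_partial s g (\<lambda>i. z (j i)) (\<lambda>i. t (j i))) \<le> B"
      using that un by (intro B) blast
    then show ?thesis
      unfolding laplace_partial_window_extension[OF g] norm_mult
      by (intro mult_mono norm_window_laplace_le_1 finite_K pos) (auto intro: order_trans[OF norm_ge_zero t])
  qed
  then show ?thesis
    unfolding laplace_bdd_set_def bounded_iff by auto
qed

text \<open>
  If \<open>g x \<noteq> 0\<close>, then the section of the extension at \<open>x\<close> is nonzero on the whole cube \<open>[0,1]\<^sup>K\<close>,
  which is not a null set.
\<close>

lemma AE_zero_if_window_extension_AE_zero: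
  assumes g[measurable]: "g \<in> borel_measurable (Pi\<^sub>M {1..s} (\<lambda>_. lborel))"
    and ae: "AE u in lebesgue_pow n. (\<forall>i\<in>{1..n}. 0 \<le> u i) \<longrightarrow> window_extension s j K g u = 0"
  shows "AE x in lebesgue_pow s. (\<forall>i\<in>{1..s}. 0 \<le> x i) \<longrightarrow> g x = 0"
proof -
  let ?S = "Pi\<^sub>M {1..s} (\<lambda>_. lborel :: real measure)"
  let ?K = "Pi\<^sub>M K (\<lambda>_. lborel :: real measure)"
  let ?N = "Pi\<^sub>M {1..n} (\<lambda>_. lborel :: real measure)"
  interpret S: sigma_finite_measure ?S by (rule lborel_product.sigma_finite) simp
  interpret K: sigma_finite_measure ?K by (rule lborel_product.sigma_finite[OF finite_K])
  interpret pair_sigma_finite ?S ?K ..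
  have glue: "glue j {1..s} K \<in> ?S \<Otimes>\<^sub>M ?K \<rightarrow>\<^sub>M ?N"
    using measurable_glue[OF inj, of K] unfolding un .
  have distr: "distr (?S \<Otimes>\<^sub>M ?K) ?N (glue j {1..s} K) = ?N"
    using distr_glue[OF inj disj finite_atLeastAtMost finite_K] unfolding un by simp
  have "AE u in ?N. (\<forall>i\<in>{1..n}. 0 \<le> u i) \<longrightarrow> window_extension s j K g u = 0"
    using ae unfolding lebesgue_pow_def AE_completion_iff .
  then have "AE u in distr (?S \<Otimes>\<^sub>M ?K) ?N (glue j {1..s} K). (\<forall>i\<in>{1..n}. 0 \<le> u i) \<longrightarrow> window_extension s j K g u = 0"
    unfolding distr .
  then have "AE p in ?S \<Otimes>\<^sub>M ?K. (\<forall>i\<in>{1..n}. 0 \<le> glue j {1..s} K p i) \<longrightarrow> window_extension s j K g (glue j {1..s} K p) = 0"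
    by (rule AE_distrD[OF glue])
  from AE_pair[OF this] AE_space
  have "AE x in ?S. (\<forall>i\<in>{1..s}. 0 \<le> x i) \<longrightarrow> g x = 0"
  proof eventually_elim
    case (elim x)
    then have x: "x \<in> extensional {1..s}" by (simp add: space_PiM PiE_iff)
    show ?case
    proof (rule ccontr, unfold not_imp, elim conjE)
      assume pos: "\<forall>i\<in>{1..s}. 0 \<le> x i" and "g x \<noteq> 0"
      from elim(1) have "AE y in ?K. y \<notin> (\<Pi>\<^sub>E i\<in>K. {0..1})"
      proof eventually_elim
        case (elim y)
        show ?case
        proof
          assume y: "y \<in> (\<Pi>\<^sub>E i\<in>K. {0..1})"
          have "\<forall>i\<in>{1..n}. 0 \<le> glue j {1..s} K (x, y) i"
            unfolding un[symmetric] using pos y inj disj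
            by (auto simp: glue_reindexed glue_other PiE_iff)
          then show False
            using elim y \<open>g x \<noteq> 0\<close> unfolding window_extension_glue[OF x] by (auto simp: PiE_iff)
        qed
      qed
      then have "emeasure ?K (\<Pi>\<^sub>E i\<in>K. {0..1}) = 0"
        using box_in_sets[OF finite_K, of "\<lambda>_. 0" "\<lambda>_. 1"]
        by (simp add: AE_iff_null_sets null_setsD1)
      then show False
        using finite_K by (simp add: lborel_product.emeasure_PiM)
    qed
  qed
  then show ?thesis
    unfolding lebesgue_pow_def by (rule AE_completion)
qed

end

section \<open>Uniqueness sequences and selection of coordinates\<close>

theorem proposition2p7:
  fixes n s :: nat and l :: "nat \<Rightarrow> nat \<Rightarrow> complex" and j :: "nat \<Rightarrow> nat"
  assumes "\<And>k i. i \<in> {1..n} \<Longrightarrow> Re (l k i) > 0"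
    and "1 \<le> s" and "s \<le> n"
    and "strict_mono_on {1..s} j" and "j ` {1..s} \<subseteq> {1..n}"
    and "laplace_uniqueness_seq n l"
  shows "laplace_uniqueness_seq s (\<lambda>k i. l k (j i))"
  unfolding laplace_uniqueness_seq_def
proof (intro allI impI, elim exE conjE)
  fix f and \<omega> :: "nat \<Rightarrow> ereal"
  assume f: "locally_integrable s f"
    and zero: "\<forall>k. laplace_transform s f (\<lambda>i. l k (j i)) = 0"
    and \<omega>_fin: "\<forall>i\<in>{1..s}. \<omega> i < \<infinity>"
    and sub: "{z. \<forall>i\<in>{1..s}. \<omega> i < ereal (Re (z i))} \<subseteq> laplace_bdd_set s f \<inter> laplace_conv_set s f"
    and \<omega>_l: "\<forall>k. \<forall>i\<in>{1..s}. \<omega> i < ereal (Re (l k (j i)))"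
  define K where "K = {1..n} - j ` {1..s}"
  interpret coordinate_split n s j K
    using assms(4,5) by unfold_locales (auto simp: K_def strict_mono_on_imp_inj_on)
  obtain g where g: "g \<in> borel_measurable (Pi\<^sub>M {1..s} (\<lambda>_. lborel))"
    and fg: "AE x in lebesgue_pow s. (\<forall>i\<in>{1..s}. 0 \<le> x i) \<longrightarrow> f x = g x"
    and g_loc: "locally_integrable s g"
    and partial: "laplace_partial s g = laplace_partial s f"
    using locally_integrable_borel_version[OF f] .
  let ?F = "window_extension s j K g"
  \<comment> \<open>The bound \<open>0\<close> keeps the window factor bounded and still lies below every \<open>Re (l k i)\<close>.\<close>
  define \<omega>' where "\<omega>' i = (if i \<in> K then 0 else \<omega> (inv_into {1..s} j i))" for i
  have \<omega>'_j: "\<omega>' (j i) = \<omega> i" if "i \<in> {1..s}" for i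
    using that disj inj by (auto simp: \<omega>'_def disjoint_iff)
  have split: "(\<forall>i\<in>{1..n}. P i) \<longleftrightarrow> (\<forall>i\<in>{1..s}. P (j i)) \<and> (\<forall>i\<in>K. P i)" for P
    unfolding un[symmetric] by blast
  have half_space: "(\<forall>i\<in>{1..n}. \<omega>' i < ereal (Re (z i))) \<longleftrightarrow>
      (\<forall>i\<in>{1..s}. \<omega> i < ereal (Re (z (j i)))) \<and> (\<forall>i\<in>K. 0 < Re (z i))" for z
    unfolding split by (simp add: \<omega>'_j) (simp add: \<omega>'_def)
  have conv: "(laplace_partial s g (\<lambda>i. z (j i)) \<longlongrightarrow> laplace_transform s f (\<lambda>i. z (j i))) (jointly_at_top s)"
    if "\<forall>i\<in>{1..s}. \<omega> i < ereal (Re (z (j i)))" for z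
  proof -
    have "(\<lambda>i. z (j i)) \<in> laplace_conv_set s f"
      using subsetD[OF sub, of "\<lambda>i. z (j i)"] that by simp
    then show ?thesis
      unfolding laplace_conv_set_def laplace_transform_def partial
      using tendsto_Lim[OF jointly_at_top_neq_bot] by blast
  qed
  have "\<exists>\<omega> :: nat \<Rightarrow> ereal. (\<forall>i\<in>{1..n}. \<omega> i < \<infinity>) \<and>
      {z. \<forall>i\<in>{1..n}. \<omega> i < ereal (Re (z i))} \<subseteq> laplace_bdd_set n ?F \<inter> laplace_conv_set n ?F \<and>
      (\<forall>k. \<forall>i\<in>{1..n}. \<omega> i < ereal (Re (l k i)))"
  proof (intro exI[of _ \<omega>'] conjI allI)
    show "\<forall>i\<in>{1..n}. \<omega>' i < \<infinity>"
      unfolding split using \<omega>_fin by (simp add: \<omega>'_j) (simp add: \<omega>'_def)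
    show "\<forall>i\<in>{1..n}. \<omega>' i < ereal (Re (l k i))" for k
      unfolding half_space using \<omega>_l assms(1) by (auto simp: K_def)
    show "{z. \<forall>i\<in>{1..n}. \<omega>' i < ereal (Re (z i))} \<subseteq> laplace_bdd_set n ?F \<inter> laplace_conv_set n ?F"
    proof (intro subsetI IntI)
      fix z assume "z \<in> {z. \<forall>i\<in>{1..n}. \<omega>' i < ereal (Re (z i))}"
      then have z: "\<forall>i\<in>{1..s}. \<omega> i < ereal (Re (z (j i)))" "\<forall>i\<in>K. 0 < Re (z i)"
        unfolding mem_Collect_eq half_space by auto
      have "(\<lambda>i. z (j i)) \<in> laplace_bdd_set s g"
        using subsetD[OF sub, of "\<lambda>i. z (j i)"] z(1) unfolding laplace_bdd_set_def partial by simp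
      then show "z \<in> laplace_bdd_set n ?F"
        using z(2) by (intro laplace_bdd_set_window_extension[OF g g_loc]) (auto intro: less_imp_le)
      show "z \<in> laplace_conv_set n ?F"
        using tendsto_laplace_partial_window_extension[OF g g_loc conv[OF z(1)]]
        unfolding laplace_conv_set_def by blast
    qed
  qed
  moreover have "laplace_transform n ?F (l k) = 0" for k
  proof -
    have "(laplace_partial n ?F (l k) \<longlongrightarrow> 0) (jointly_at_top n)"
      using tendsto_laplace_partial_window_extension[OF g g_loc conv, of "l k"] \<omega>_l zero by simp
    then show ?thesis
      unfolding laplace_transform_def by (rule tendsto_Lim[OF jointly_at_top_neq_bot])
  qed
  ultimately have "AE u in lebesgue_pow n. (\<forall>i\<in>{1..n}. 0 \<le> u i) \<longrightarrow> ?F u = 0"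
    using assms(6) locally_integrable_window_extension[OF g g_loc]
    unfolding laplace_uniqueness_seq_def by blast
  then have "AE x in lebesgue_pow s. (\<forall>i\<in>{1..s}. 0 \<le> x i) \<longrightarrow> g x = 0"
    by (rule AE_zero_if_window_extension_AE_zero[OF g])
  with fg show "AE x in lebesgue_pow s. (\<forall>i\<in>{1..s}. 0 \<le> x i) \<longrightarrow> f x = 0"
    by eventually_elim simp
qed

end
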